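(* Suppose $X$ and $Y$ are compact metric spaces. Then $X$ and $Y$ are Boolean equivalent if and only if $\mathrm{isol}(X)$ has the same cardinality as $\mathrm{isol}(Y)$ and either $X_c=Y_c=\emptyset$ or both $X_c$ and $Y_c$ are non-empty.
   Context: For a compact Hausdorff space $X$, an open set $V\subseteq X$ is regular open if $V=\operatorname{int}(\operatorname{cl}(V))$; $\mathrm{Ropen}(X)$ denotes the Boolean algebra of regular open subsets of $X$ with operations $V_1\vee V_2=\operatorname{int}(\operatorname{cl}(V_1\cup V_2))$, $V_1\wedge V_2=V_1\cap V_2$, $\neg V=X\setminus\operatorname{cl}(V)$. Two compact Hausdorff spaces $X$ and $Y$ are Boolean equivalent if $\mathrm{Ropen}(X)$ and $\mathrm{Ropen}(Y)$ are isomorphic Boolean algebras. For a space $Y$, $\mathrm{isol}(Y)$ is the set of isolated points of $Y$, $Y_a:=\operatorname{cl}(\mathrm{isol}(Y))$ and $Y_c:=\operatorname{cl}(Y\setminus Y_a)$; similarly for $X$. *)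

theory Defs
  imports "HOL-Analysis.Analysis" "HOL-Library.Equipollence"
begin

definition regular_open_in :: "'a topology \<Rightarrow> 'a set \<Rightarrow> bool"
  where "regular_open_in X V \<longleftrightarrow> openin X V \<and> V = X interior_of (X closure_of V)"

record 'a boolean_algebra_ops =
  elements :: "'a set"
  bjoin :: "'a \<Rightarrow> 'a \<Rightarrow> 'a"
  bmeet :: "'a \<Rightarrow> 'a \<Rightarrow> 'a"
  bneg :: "'a \<Rightarrow> 'a"

text \<open>The bottom and top elements need no separate clause in an isomorphism: in a Boolean
  algebra they are the meet and the join of any element with its complement.\<close>

definition boolean_isomorphism ::
  "'a boolean_algebra_ops \<Rightarrow> 'b boolean_algebra_ops \<Rightarrow> ('a \<Rightarrow> 'b) \<Rightarrow> bool"
  where "boolean_isomorphism A B f \<longleftrightarrow>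
    bij_betw f (elements A) (elements B) \<and>
    (\<forall>u\<in>elements A. \<forall>v\<in>elements A. f (bjoin A u v) = bjoin B (f u) (f v)) \<and>
    (\<forall>u\<in>elements A. \<forall>v\<in>elements A. f (bmeet A u v) = bmeet B (f u) (f v)) \<and>
    (\<forall>u\<in>elements A. f (bneg A u) = bneg B (f u))"

definition isomorphic_boolean_algebras ::
  "'a boolean_algebra_ops \<Rightarrow> 'b boolean_algebra_ops \<Rightarrow> bool"
  where "isomorphic_boolean_algebras A B \<longleftrightarrow> (\<exists>f. boolean_isomorphism A B f)"

definition Ropen :: "'a topology \<Rightarrow> 'a set boolean_algebra_ops"
  where "Ropen X =
    \<lparr> elements = {V. regular_open_in X V},
      bjoin = (\<lambda>V W. X interior_of (X closure_of (V \<union> W))),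
      bmeet = (\<lambda>V W. V \<inter> W),
      bneg = (\<lambda>V. topspace X - X closure_of V) \<rparr>"

definition boolean_equivalent :: "'a topology \<Rightarrow> 'b topology \<Rightarrow> bool"
  where "boolean_equivalent X Y \<longleftrightarrow> isomorphic_boolean_algebras (Ropen X) (Ropen Y)"

definition isol :: "'a topology \<Rightarrow> 'a set"
  where "isol X = {x \<in> topspace X. openin X {x}}"

text \<open>\<open>isol_closure X\<close> and \<open>nonisol_part X\<close> are the sets usually
  written \<open>X\<^sub>a\<close> and \<open>X\<^sub>c\<close>.\<close>

definition isol_closure :: "'a topology \<Rightarrow> 'a set"
  where "isol_closure X = X closure_of (isol X)"

definition nonisol_part :: "'a topology \<Rightarrow> 'a set"
  where "nonisol_part X = X closure_of (topspace X - isol_closure X)"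

end

theory Submission
  imports Defs "HOL-Library.Sublist"
begin

text \<open>
  The atoms of the algebra of regular open sets are the singletons of isolated points, and
  \<open>nonisol_part X\<close> is empty exactly when this algebra is atomic; both data are therefore
  invariants of the algebra.

  Conversely, the algebra is determined by the disjointness pattern of any pi-base. Outside
  the closure of the isolated points, a second countable Hausdorff space has a pi-base indexed
  by the finite sequences of natural numbers in which two members meet exactly when one index
  extends the other. Adding the singletons of isolated points gives a pi-base of the whole
  space, whose pattern depends only on the number of isolated points and on whether the
  tree is present.
\<close>

section \<open>Regular open sets\<close>

lemma regular_open_in_interior_closure:
  "regular_open_in X (X interior_of (X closure_of S))"
proof -
  let ?W = "X interior_of (X closure_of S)"
  have "X closure_of ?W \<subseteq> X closure_of S"
    by (simp add: closure_of_minimal interior_of_subset)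
  then have "X interior_of (X closure_of ?W) \<subseteq> ?W"
    by (rule interior_of_mono)
  moreover have "?W \<subseteq> X interior_of (X closure_of ?W)"
    by (simp add: closure_of_subset interior_of_maximal interior_of_subset_topspace)
  ultimately show ?thesis
    by (auto simp: regular_open_in_def)
qed

lemma openin_subset_regular_open_in:
  assumes "regular_open_in X V" "openin X U" "U \<subseteq> X closure_of V"
  shows "U \<subseteq> V"
  using assms unfolding regular_open_in_def by (metis interior_of_maximal)

lemma openin_subset_interior_closure:
  assumes "openin X U" "U \<subseteq> S"
  shows "U \<subseteq> X interior_of (X closure_of S)"
proof (rule interior_of_maximal)
  have "U \<subseteq> X closure_of U"
    by (simp add: assms(1) closure_of_subset openin_subset)
  also have "\<dots> \<subseteq> X closure_of S"
    by (rule closure_of_mono) fact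
  finally show "U \<subseteq> X closure_of S" .
qed fact

lemma interior_closure_subset_regular_open_in:
  assumes "regular_open_in X V" "S \<subseteq> V"
  shows "X interior_of (X closure_of S) \<subseteq> V"
  using assms unfolding regular_open_in_def by (metis closure_of_mono interior_of_mono)

lemma regular_open_in_imp_openin: "regular_open_in X V \<Longrightarrow> openin X V"
  by (simp add: regular_open_in_def)

lemma regular_open_in_empty [simp]: "regular_open_in X {}"
  by (simp add: regular_open_in_def)

lemma regular_open_in_Int:
  assumes "regular_open_in X U" "regular_open_in X V"
  shows "regular_open_in X (U \<inter> V)"
proof -
  have op: "openin X (U \<inter> V)"
    using assms by (auto simp: regular_open_in_def)
  have "X interior_of (X closure_of (U \<inter> V)) \<subseteq> U \<inter> V"
    using interior_closure_subset_regular_open_in[of X _ "U \<inter> V"] assms by blast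
  then show ?thesis
    using op openin_subset_interior_closure[OF op order_refl] by (auto simp: regular_open_in_def)
qed

text \<open>The complement of the closure of \<open>U\<close> is the interior of the closed set
  \<open>topspace X - U\<close>, and the interior of a closed set is regular open.\<close>

lemma regular_open_in_complement_closure:
  assumes "openin X U"
  shows "regular_open_in X (topspace X - X closure_of U)"
proof -
  have "X closure_of (topspace X - U) = topspace X - U"
    using assms by (simp add: closure_of_closedin closedin_diff)
  then have "topspace X - X closure_of U = X interior_of (X closure_of (topspace X - U))"
    by (simp add: interior_of_complement)
  then show ?thesis
    by (metis regular_open_in_interior_closure)
qed

section \<open>Boolean isomorphisms as order isomorphisms\<close>

text \<open>Inclusion determines all the operations: the meet is the infimum, the join the least
  regular open set above both arguments, the complement the largest one disjoint from its argument.
  Building an isomorphism thus reduces to building an order isomorphism.\<close>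

lemma boolean_isomorphism_Ropen_iff:
  "boolean_isomorphism (Ropen X) (Ropen Y) f \<longleftrightarrow>
    bij_betw f {V. regular_open_in X V} {W. regular_open_in Y W} \<and>
    (\<forall>U V. regular_open_in X U \<longrightarrow> regular_open_in X V \<longrightarrow> (f U \<subseteq> f V \<longleftrightarrow> U \<subseteq> V))"
    (is "?iso \<longleftrightarrow> ?bij \<and> ?mono")
proof
  assume ?iso
  then have bij: ?bij and
    meet: "\<And>U V. regular_open_in X U \<Longrightarrow> regular_open_in X V \<Longrightarrow> f (U \<inter> V) = f U \<inter> f V"
    by (auto simp: boolean_isomorphism_def Ropen_def)
  have "f U \<subseteq> f V \<longleftrightarrow> U \<subseteq> V" if "regular_open_in X U" "regular_open_in X V" for U V
  proof -
    have "f U \<subseteq> f V \<longleftrightarrow> f (U \<inter> V) = f U"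
      by (auto simp: meet that)
    also have "\<dots> \<longleftrightarrow> U \<inter> V = U"
      using bij that regular_open_in_Int[OF that] unfolding bij_betw_def
      by (metis inj_on_contraD mem_Collect_eq)
    finally show ?thesis by blast
  qed
  with bij show "?bij \<and> ?mono" by blast
next
  assume "?bij \<and> ?mono"
  then have bij: ?bij and
    mono: "\<And>U V. regular_open_in X U \<Longrightarrow> regular_open_in X V \<Longrightarrow> f U \<subseteq> f V \<longleftrightarrow> U \<subseteq> V"
    by auto
  have reg: "regular_open_in Y (f U)" if "regular_open_in X U" for U
    using bij that by (auto simp: bij_betw_def)
  have surj: "\<exists>U. regular_open_in X U \<and> f U = W" if "regular_open_in Y W" for W
    using bij that by (metis bij_betw_imp_surj_on image_iff mem_Collect_eq)
  have empty: "f {} = {}"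
  proof -
    obtain E where "regular_open_in X E" "f E = {}"
      using surj[OF regular_open_in_empty] by blast
    then show ?thesis
      using mono[OF regular_open_in_empty, of E] by simp
  qed
  have meet: "f (U \<inter> V) = f U \<inter> f V" if U: "regular_open_in X U" and V: "regular_open_in X V" for U V
  proof
    show "f (U \<inter> V) \<subseteq> f U \<inter> f V"
      by (simp add: U V mono regular_open_in_Int)
    \<comment> \<open>Pulling the target back along the surjection \<open>f\<close> lets the order
      in \<open>X\<close> compare it with \<open>U \<inter> V\<close>; joins and complements are
      treated in the same way.\<close>
    obtain W where W: "regular_open_in X W" "f W = f U \<inter> f V"
      using surj regular_open_in_Int[OF reg[OF U] reg[OF V]] by blast
    then have "W \<subseteq> U \<inter> V"
      using mono U V by (metis Int_greatest Int_lower1 Int_lower2)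
    then show "f U \<inter> f V \<subseteq> f (U \<inter> V)"
      using W mono U V regular_open_in_Int by metis
  qed
  have join: "f (X interior_of (X closure_of (U \<union> V))) = Y interior_of (Y closure_of (f U \<union> f V))"
    if U: "regular_open_in X U" and V: "regular_open_in X V" for U V
  proof
    let ?J = "X interior_of (X closure_of (U \<union> V))"
    let ?K = "Y interior_of (Y closure_of (f U \<union> f V))"
    have J: "regular_open_in X ?J"
      by (rule regular_open_in_interior_closure)
    have UV: "U \<subseteq> ?J" "V \<subseteq> ?J" "f U \<subseteq> ?K" "f V \<subseteq> ?K"
      by (intro openin_subset_interior_closure regular_open_in_imp_openin U V reg; simp)+
    show "?K \<subseteq> f ?J"
      by (intro interior_closure_subset_regular_open_in reg J) (use UV mono U V J in auto)
    obtain W where W: "regular_open_in X W" "f W = ?K"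
      using surj regular_open_in_interior_closure by blast
    then have "U \<union> V \<subseteq> W"
      using UV mono U V by (metis Un_least)
    then have "?J \<subseteq> W"
      by (intro interior_closure_subset_regular_open_in W)
    then show "f ?J \<subseteq> ?K"
      using W J mono by metis
  qed
  have neg: "f (topspace X - X closure_of V) = topspace Y - Y closure_of (f V)"
    if V: "regular_open_in X V" for V
  proof
    let ?N = "topspace X - X closure_of V"
    have N: "regular_open_in X ?N"
      using V by (simp add: regular_open_in_complement_closure regular_open_in_imp_openin)
    have "V \<subseteq> X closure_of V"
      using V by (simp add: closure_of_subset openin_subset regular_open_in_imp_openin)
    then have "?N \<inter> V = {}" by blast
    then have "f ?N \<inter> f V = {}"
      using meet[OF N V] empty by simp
    then have "f ?N \<inter> Y closure_of (f V) = {}"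
      by (simp add: openin_Int_closure_of_eq_empty reg[OF N] regular_open_in_imp_openin)
    then show "f ?N \<subseteq> topspace Y - Y closure_of (f V)"
      using reg[OF N] by (auto dest: regular_open_in_imp_openin openin_subset)
    obtain W where W: "regular_open_in X W" "f W = topspace Y - Y closure_of (f V)"
      using surj regular_open_in_complement_closure reg[OF V] regular_open_in_imp_openin by metis
    have "f V \<subseteq> Y closure_of f V"
      using reg[OF V] by (simp add: closure_of_subset openin_subset regular_open_in_imp_openin)
    then have "f (W \<inter> V) \<subseteq> f {}"
      using meet[OF W(1) V] W(2) by auto
    then have "W \<inter> V = {}"
      using mono[OF regular_open_in_Int[OF W(1) V] regular_open_in_empty] by blast
    \<comment> \<open>An open set disjoint from \<open>V\<close> also misses the closure of
      \<open>V\<close>.\<close>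
    then have "W \<inter> X closure_of V = {}"
      by (simp add: openin_Int_closure_of_eq_empty W regular_open_in_imp_openin)
    then have "W \<subseteq> ?N"
      using W by (auto dest: regular_open_in_imp_openin openin_subset)
    then show "topspace Y - Y closure_of (f V) \<subseteq> f ?N"
      using W N mono by metis
  qed
  show ?iso
    using bij meet join neg by (simp add: boolean_isomorphism_def Ropen_def)
qed

section \<open>Atoms and isolated points\<close>

definition regular_open_atom :: "'a topology \<Rightarrow> 'a set \<Rightarrow> bool"
  where "regular_open_atom X V \<longleftrightarrow> regular_open_in X V \<and> V \<noteq> {} \<and>
    (\<forall>W. regular_open_in X W \<longrightarrow> W \<subseteq> V \<longrightarrow> W = {} \<or> W = V)"

lemma regular_open_in_isol:
  assumes "Hausdorff_space X" "x \<in> isol X"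
  shows "regular_open_in X {x}"
  using assms
  by (auto simp: isol_def regular_open_in_def closedin_Hausdorff_singleton closure_of_closedin
      interior_of_openin)

text \<open>Two points of an atom could be separated by open sets, and the regularization of a part
  of the atom would keep one point and lose the other. Conversely, the singleton of an isolated
  point is both open and closed, and has no proper nonempty subset.\<close>

lemma regular_open_atom_iff:
  assumes X: "Hausdorff_space X"
  shows "regular_open_atom X V \<longleftrightarrow> (\<exists>x\<in>isol X. V = {x})"
proof
  assume V: "regular_open_atom X V"
  then have opV: "openin X V" and "V \<noteq> {}"
    by (auto simp: regular_open_atom_def regular_open_in_def)
  then obtain x where x: "x \<in> V" by blast
  have "y = x" if y: "y \<in> V" for y
  proof (rule ccontr)
    assume "y \<noteq> x"
    moreover have "x \<in> topspace X" "y \<in> topspace X"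
      using x y openin_subset[OF opV] by auto
    ultimately obtain A B where AB: "openin X A" "openin X B" "x \<in> A" "y \<in> B" "disjnt A B"
      using X unfolding Hausdorff_space_def by metis
    let ?W = "X interior_of (X closure_of (A \<inter> V))"
    have "x \<in> ?W"
      using openin_subset_interior_closure[of X "A \<inter> V" "A \<inter> V"] AB opV x by auto
    moreover have "?W \<subseteq> V"
      using V by (intro interior_closure_subset_regular_open_in) (auto simp: regular_open_atom_def)
    moreover have "B \<inter> X closure_of (A \<inter> V) = {}"
      using AB by (subst openin_Int_closure_of_eq_empty) (auto simp: disjnt_iff)
    then have "y \<notin> ?W"
      using AB interior_of_subset by fastforce
    ultimately show False
      using V y regular_open_in_interior_closure[of X "A \<inter> V"]
      unfolding regular_open_atom_def by blast
  qed
  then have "V = {x}" using x by blast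
  then show "\<exists>x\<in>isol X. V = {x}"
    using opV openin_subset unfolding isol_def by fastforce
next
  assume "\<exists>x\<in>isol X. V = {x}"
  then show "regular_open_atom X V"
    using regular_open_in_isol[OF X] by (auto simp: regular_open_atom_def)
qed

lemma isol_eqpoll_atoms:
  assumes "Hausdorff_space X"
  shows "isol X \<approx> {V. regular_open_atom X V}"
proof -
  have "{V. regular_open_atom X V} = (\<lambda>x. {x}) ` isol X"
    using regular_open_atom_iff[OF assms] by auto
  then show ?thesis
    by (simp add: eqpoll_sym inj_on_image_eqpoll_self inj_on_def)
qed

text \<open>Both sides say that the isolated points are dense. The right side mentions only the
  order of the algebra, so it is preserved by isomorphisms.\<close>

lemma nonisol_part_eq_empty_iff:
  assumes X: "Hausdorff_space X"
  shows "nonisol_part X = {} \<longleftrightarrow>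
    (\<forall>V. regular_open_in X V \<longrightarrow> V \<noteq> {} \<longrightarrow> (\<exists>A. regular_open_atom X A \<and> A \<subseteq> V))"
proof -
  have isol: "isol X \<subseteq> topspace X" "openin X (isol X)"
    by (auto simp: isol_def) (subst openin_subopen, auto)
  have "nonisol_part X = {} \<longleftrightarrow> topspace X - X closure_of (isol X) = {}"
    unfolding nonisol_part_def isol_closure_def by (simp add: closure_of_eq_empty)
  also have "\<dots> \<longleftrightarrow> (\<forall>V. regular_open_in X V \<longrightarrow> V \<noteq> {} \<longrightarrow> V \<inter> isol X \<noteq> {})"
  proof
    assume "topspace X - X closure_of isol X = {}"
    then show "\<forall>V. regular_open_in X V \<longrightarrow> V \<noteq> {} \<longrightarrow> V \<inter> isol X \<noteq> {}"
      by (metis Diff_eq_empty_iff inf.orderE inf.absorb_iff1 openin_Int_closure_of_eq_empty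
          openin_subset regular_open_in_imp_openin subset_trans)
  next
    \<comment> \<open>The set to test is the complement of the closure of the isolated points, which
      is itself regular open.\<close>
    assume "\<forall>V. regular_open_in X V \<longrightarrow> V \<noteq> {} \<longrightarrow> V \<inter> isol X \<noteq> {}"
    moreover have "(topspace X - X closure_of isol X) \<inter> isol X = {}"
      using closure_of_subset[OF isol(1)] by blast
    ultimately show "topspace X - X closure_of isol X = {}"
      using regular_open_in_complement_closure[OF isol(2)] by blast
  qed
  also have "\<dots> \<longleftrightarrow> (\<forall>V. regular_open_in X V \<longrightarrow> V \<noteq> {} \<longrightarrow> (\<exists>A. regular_open_atom X A \<and> A \<subseteq> V))"
    unfolding regular_open_atom_iff[OF X] by blast
  finally show ?thesis .
qed

section \<open>Invariance of atoms and atomicity under isomorphism\<close>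

lemma boolean_isomorphism_RopenD:
  assumes "boolean_isomorphism (Ropen X) (Ropen Y) f"
  shows "\<And>U. regular_open_in X U \<Longrightarrow> regular_open_in Y (f U)"
    and "\<And>U V. regular_open_in X U \<Longrightarrow> regular_open_in X V \<Longrightarrow> f U \<subseteq> f V \<longleftrightarrow> U \<subseteq> V"
    and "\<And>W. regular_open_in Y W \<Longrightarrow> \<exists>U. regular_open_in X U \<and> f U = W"
    and "\<And>U. regular_open_in X U \<Longrightarrow> f U = {} \<longleftrightarrow> U = {}"
proof -
  have bij: "bij_betw f {V. regular_open_in X V} {W. regular_open_in Y W}" and
    mono: "\<And>U V. regular_open_in X U \<Longrightarrow> regular_open_in X V \<Longrightarrow> f U \<subseteq> f V \<longleftrightarrow> U \<subseteq> V"
    using assms unfolding boolean_isomorphism_Ropen_iff by auto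
  then show "\<And>U V. regular_open_in X U \<Longrightarrow> regular_open_in X V \<Longrightarrow> f U \<subseteq> f V \<longleftrightarrow> U \<subseteq> V"
    by blast
  show "\<And>U. regular_open_in X U \<Longrightarrow> regular_open_in Y (f U)"
    using bij by (auto simp: bij_betw_def)
  show surj: "\<exists>U. regular_open_in X U \<and> f U = W" if "regular_open_in Y W" for W
    using bij that by (metis bij_betw_imp_surj_on image_iff mem_Collect_eq)
  show "f U = {} \<longleftrightarrow> U = {}" if "regular_open_in X U" for U
  proof -
    obtain E where "regular_open_in X E" "f E = {}"
      using surj[OF regular_open_in_empty] by blast
    then show ?thesis
      using mono[OF that, of E] mono[OF regular_open_in_empty, of E]
        mono[OF that regular_open_in_empty] by auto
  qed
qed

lemma boolean_isomorphism_Ropen_atom: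
  assumes f: "boolean_isomorphism (Ropen X) (Ropen Y) f" and U: "regular_open_in X U"
  shows "regular_open_atom Y (f U) \<longleftrightarrow> regular_open_atom X U"
proof -
  note D = boolean_isomorphism_RopenD[OF f]
  \<comment> \<open>Since \<open>f\<close> is onto, a quantifier over regular open sets of
    \<open>Y\<close> can be moved to \<open>X\<close>.\<close>
  have all: "(\<forall>W. regular_open_in Y W \<longrightarrow> P W) \<longleftrightarrow> (\<forall>V. regular_open_in X V \<longrightarrow> P (f V))" for P
    using D(1,3) by blast
  have inj: "f V = f U \<longleftrightarrow> V = U" if "regular_open_in X V" for V
    using D(2)[OF that U] D(2)[OF U that] by blast
  show ?thesis
    unfolding regular_open_atom_def all using U by (auto simp: D inj)
qed

lemma boolean_equivalentD:
  assumes X: "Hausdorff_space X" and Y: "Hausdorff_space Y" and "boolean_equivalent X Y"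
  shows "isol X \<approx> isol Y" and "nonisol_part X = {} \<longleftrightarrow> nonisol_part Y = {}"
proof -
  obtain f where f: "boolean_isomorphism (Ropen X) (Ropen Y) f"
    using assms(3) unfolding boolean_equivalent_def isomorphic_boolean_algebras_def by blast
  note D = boolean_isomorphism_RopenD[OF f]
  note atom = boolean_isomorphism_Ropen_atom[OF f]
  have bij: "bij_betw f {V. regular_open_in X V} {W. regular_open_in Y W}"
    using f by (simp add: boolean_isomorphism_Ropen_iff)
  have "f ` {V. regular_open_atom X V} = {V. regular_open_atom Y V}"
  proof (intro subset_antisym subsetI)
    show "W \<in> {V. regular_open_atom Y V}" if "W \<in> f ` {V. regular_open_atom X V}" for W
      using that atom by (auto simp: regular_open_atom_def)
    show "W \<in> f ` {V. regular_open_atom X V}" if "W \<in> {V. regular_open_atom Y V}" for W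
    proof -
      have "regular_open_in Y W"
        using that by (simp add: regular_open_atom_def)
      then obtain U where "regular_open_in X U" "f U = W"
        using D(3) by blast
      then show ?thesis
        using that atom by blast
    qed
  qed
  then have "bij_betw f {V. regular_open_atom X V} {V. regular_open_atom Y V}"
    by (intro bij_betw_subset[OF bij]) (auto simp: regular_open_atom_def)
  then have "{V. regular_open_atom X V} \<approx> {V. regular_open_atom Y V}"
    unfolding eqpoll_def by blast
  then show "isol X \<approx> isol Y"
    using isol_eqpoll_atoms[OF X] isol_eqpoll_atoms[OF Y] by (meson eqpoll_sym eqpoll_trans)
  have all: "(\<forall>W. regular_open_in Y W \<longrightarrow> P W) \<longleftrightarrow> (\<forall>V. regular_open_in X V \<longrightarrow> P (f V))" for P
    using D(1,3) by blast
  have "(\<exists>A. regular_open_atom Y A \<and> A \<subseteq> f V) \<longleftrightarrow> (\<exists>A. regular_open_atom X A \<and> A \<subseteq> V)"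
    if V: "regular_open_in X V" for V
  proof -
    show ?thesis
    proof
      assume "\<exists>A. regular_open_atom Y A \<and> A \<subseteq> f V"
      then obtain W where W: "regular_open_atom Y W" "W \<subseteq> f V" by blast
      then have "regular_open_in Y W"
        by (simp add: regular_open_atom_def)
      then obtain A where A: "regular_open_in X A" "f A = W"
        using D(3) by blast
      then show "\<exists>A. regular_open_atom X A \<and> A \<subseteq> V"
        using W atom[OF A(1)] D(2)[OF A(1) V] by blast
    next
      assume "\<exists>A. regular_open_atom X A \<and> A \<subseteq> V"
      then obtain A where A: "regular_open_atom X A" "A \<subseteq> V" by blast
      then have "regular_open_in X A"
        by (simp add: regular_open_atom_def)
      then show "\<exists>A. regular_open_atom Y A \<and> A \<subseteq> f V"
        using A atom D(2)[OF _ V] by blast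
    qed
  qed
  then show "nonisol_part X = {} \<longleftrightarrow> nonisol_part Y = {}"
    unfolding nonisol_part_eq_empty_iff[OF X] nonisol_part_eq_empty_iff[OF Y] all
    using D(4) by auto
qed

section \<open>Pi-bases with the same disjointness pattern\<close>

text \<open>An indexed family rather than a set of sets, so that pi-bases of two different spaces
  can be compared over one index set.\<close>

definition pi_base :: "'a topology \<Rightarrow> 'i set \<Rightarrow> ('i \<Rightarrow> 'a set) \<Rightarrow> bool"
  where "pi_base X I A \<longleftrightarrow> (\<forall>i\<in>I. openin X (A i) \<and> A i \<noteq> {}) \<and>
    (\<forall>U. openin X U \<longrightarrow> U \<noteq> {} \<longrightarrow> (\<exists>i\<in>I. A i \<subseteq> U))"

definition pi_base_transfer ::
  "'b topology \<Rightarrow> 'i set \<Rightarrow> ('i \<Rightarrow> 'a set) \<Rightarrow> ('i \<Rightarrow> 'b set) \<Rightarrow> 'a set \<Rightarrow> 'b set"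
  where "pi_base_transfer Y I A B V =
    Y interior_of (Y closure_of (\<Union>i\<in>{i\<in>I. A i \<subseteq> V}. B i))"

lemma regular_open_in_transfer: "regular_open_in Y (pi_base_transfer Y I A B V)"
  unfolding pi_base_transfer_def by (rule regular_open_in_interior_closure)

lemma pi_base_transfer_mono:
  "U \<subseteq> V \<Longrightarrow> pi_base_transfer Y I A B U \<subseteq> pi_base_transfer Y I A B V"
  unfolding pi_base_transfer_def by (intro interior_of_mono closure_of_mono) blast

text \<open>The members inside \<open>V\<close> have a union that is dense in \<open>V\<close>:
  otherwise the open remainder of \<open>V\<close> would contain a further member, which already
  belongs to that union.\<close>

lemma pi_base_transfer_self:
  assumes A: "pi_base X I A" and V: "regular_open_in X V"
  shows "pi_base_transfer X I A A V = V"
proof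
  let ?S = "\<Union>i\<in>{i\<in>I. A i \<subseteq> V}. A i"
  show "pi_base_transfer X I A A V \<subseteq> V"
    unfolding pi_base_transfer_def using V
    by (rule interior_closure_subset_regular_open_in) blast
  have opV: "openin X V"
    using V by (rule regular_open_in_imp_openin)
  have "V \<subseteq> X closure_of ?S"
  proof (rule ccontr)
    assume "\<not> V \<subseteq> X closure_of ?S"
    then have "V - X closure_of ?S \<noteq> {}" "openin X (V - X closure_of ?S)"
      using opV by (auto intro: openin_diff)
    then obtain k where k: "k \<in> I" "A k \<subseteq> V - X closure_of ?S"
      using A unfolding pi_base_def by metis
    have "A k \<subseteq> X closure_of A k" "A k \<noteq> {}"
      using A k(1) unfolding pi_base_def by (auto simp: closure_of_subset openin_subset)
    moreover have "X closure_of A k \<subseteq> X closure_of ?S"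
      using k by (intro closure_of_mono) blast
    ultimately show False
      using k(2) by blast
  qed
  then show "V \<subseteq> pi_base_transfer X I A A V"
    unfolding pi_base_transfer_def using opV by (rule interior_of_maximal)
qed

text \<open>The transfer remembers which members lay inside \<open>V\<close>. If \<open>A j\<close>
  is not inside \<open>V\<close>, some \<open>A k\<close> lies in \<open>A j\<close> outside the
  closure of \<open>V\<close>. It is disjoint from every \<open>A i\<close> inside \<open>V\<close>,
  so by the common pattern \<open>B k\<close> misses the transfer of \<open>V\<close> although it
  meets \<open>B j\<close>.\<close>

lemma pi_base_transfer_subset_iff:
  assumes A: "pi_base X I A" and B: "pi_base Y I B"
    and disj: "\<And>i j. i \<in> I \<Longrightarrow> j \<in> I \<Longrightarrow> A i \<inter> A j = {} \<longleftrightarrow> B i \<inter> B j = {}"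
    and V: "regular_open_in X V" and j: "j \<in> I"
  shows "B j \<subseteq> pi_base_transfer Y I A B V \<longleftrightarrow> A j \<subseteq> V"
proof
  have "openin Y (B j)"
    using B j by (auto simp: pi_base_def)
  moreover assume "A j \<subseteq> V"
  ultimately show "B j \<subseteq> pi_base_transfer Y I A B V"
    unfolding pi_base_transfer_def using j
    by (intro openin_subset_interior_closure) auto
next
  have opA: "openin X (A i)" "A i \<noteq> {}" and opB: "openin Y (B i)" if "i \<in> I" for i
    using A B that by (auto simp: pi_base_def)
  let ?S = "\<Union>i\<in>{i\<in>I. A i \<subseteq> V}. B i"
  assume sub: "B j \<subseteq> pi_base_transfer Y I A B V"
  show "A j \<subseteq> V"
  proof (rule ccontr)
    assume "\<not> A j \<subseteq> V"
    \<comment> \<open>Regularity of \<open>V\<close> enters here: an open set inside the closure of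
      \<open>V\<close> is already inside \<open>V\<close>.\<close>
    then have "\<not> A j \<subseteq> X closure_of V"
      using openin_subset_regular_open_in[OF V opA(1)[OF j]] by blast
    then have "A j - X closure_of V \<noteq> {}" "openin X (A j - X closure_of V)"
      using opA[OF j] by (auto intro: openin_diff)
    then obtain k where k: "k \<in> I" "A k \<subseteq> A j - X closure_of V"
      using A unfolding pi_base_def by metis
    have "V \<subseteq> X closure_of V"
      using V by (simp add: closure_of_subset openin_subset regular_open_in_imp_openin)
    then have "A k \<inter> A i = {}" if "A i \<subseteq> V" for i
      using k that by blast
    then have "B k \<inter> ?S = {}"
      using disj k(1) by blast
    then have "B k \<inter> Y closure_of ?S = {}"
      using opB[OF k(1)] openin_Int_closure_of_eq_empty by blast
    then have "B k \<inter> pi_base_transfer Y I A B V = {}"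
      unfolding pi_base_transfer_def using interior_of_subset[of Y "Y closure_of ?S"] by blast
    moreover have "B k \<inter> B j \<noteq> {}"
      using disj[OF k(1) j] k opA[OF k(1)] by blast
    ultimately show False
      using sub by blast
  qed
qed

text \<open>A transfer depends only on the set of indices selected, and the transfer back selects
  the same indices.\<close>

lemma pi_base_transfer_inverse:
  assumes A: "pi_base X I A" and B: "pi_base Y I B"
    and disj: "\<And>i j. i \<in> I \<Longrightarrow> j \<in> I \<Longrightarrow> A i \<inter> A j = {} \<longleftrightarrow> B i \<inter> B j = {}"
    and V: "regular_open_in X V"
  shows "pi_base_transfer X I B A (pi_base_transfer Y I A B V) = V"
proof -
  have "{i \<in> I. B i \<subseteq> pi_base_transfer Y I A B V} = {i \<in> I. A i \<subseteq> V}"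
    using pi_base_transfer_subset_iff[OF A B disj V] by blast
  then have "pi_base_transfer X I B A (pi_base_transfer Y I A B V) = pi_base_transfer X I A A V"
    by (simp add: pi_base_transfer_def)
  then show ?thesis
    using pi_base_transfer_self[OF A V] by simp
qed

lemma boolean_equivalent_pi_bases:
  assumes A: "pi_base X I A" and B: "pi_base Y I B"
    and disj: "\<And>i j. i \<in> I \<Longrightarrow> j \<in> I \<Longrightarrow> A i \<inter> A j = {} \<longleftrightarrow> B i \<inter> B j = {}"
  shows "boolean_equivalent X Y"
proof -
  let ?f = "pi_base_transfer Y I A B" and ?g = "pi_base_transfer X I B A"
  have gf: "?g (?f V) = V" if "regular_open_in X V" for V
    by (rule pi_base_transfer_inverse[OF A B disj that])
  have fg: "?f (?g W) = W" if "regular_open_in Y W" for W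
    by (rule pi_base_transfer_inverse[OF B A disj[symmetric] that])
  have "bij_betw ?f {V. regular_open_in X V} {W. regular_open_in Y W}"
    by (rule bij_betw_byWitness[where f' = ?g]) (auto simp: gf fg regular_open_in_transfer)
  \<comment> \<open>The order is reflected because the inverse \<open>?g\<close> is monotone
    too.\<close>
  moreover have "?f U \<subseteq> ?f V \<longleftrightarrow> U \<subseteq> V" if "regular_open_in X U" "regular_open_in X V" for U V
    using pi_base_transfer_mono[of U V Y I A B] pi_base_transfer_mono[of "?f U" "?f V" X I B A]
    unfolding gf[OF that(1)] gf[OF that(2)] by blast
  ultimately show ?thesis
    unfolding boolean_equivalent_def isomorphic_boolean_algebras_def boolean_isomorphism_Ropen_iff
    by blast
qed

section \<open>Trees of open sets in spaces without isolated points\<close>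

text \<open>Each member contains a point of a countable dense set, and disjoint members yield
  different points.\<close>

lemma countable_disjoint_openin:
  assumes "separable_space X" and disj: "pairwise disjnt M"
    and M: "\<And>G. G \<in> M \<Longrightarrow> openin X G \<and> G \<noteq> {}"
  shows "countable M"
proof -
  obtain C where C: "countable C" "C \<subseteq> topspace X" "X closure_of C = topspace X"
    using assms(1) unfolding separable_space_def by blast
  have "\<exists>c. c \<in> G \<inter> C" if G: "G \<in> M" for G
  proof -
    have "G \<inter> X closure_of C \<noteq> {}"
      using M[OF G] C(3) openin_subset by fastforce
    then show ?thesis
      using openin_Int_closure_of_eq_empty M[OF G] by blast
  qed
  then obtain c where c: "\<And>G. G \<in> M \<Longrightarrow> c G \<in> G \<inter> C"
    by metis
  have "inj_on c M"
  proof (rule inj_onI)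
    fix G H assume "G \<in> M" "H \<in> M" "c G = c H"
    then show "G = H"
      using c[of G] c[of H] disj unfolding pairwise_def disjnt_iff by (metis IntD1)
  qed
  moreover have "countable (c ` M)"
    using c C(1) by (auto intro: countable_subset[of _ C])
  ultimately show ?thesis
    using countable_image_inj_on by blast
qed

text \<open>One branching step of the tree. Maximality makes the disjoint family dense in
  \<open>U\<close>, separability makes it countable, and the absence of isolated points makes it
  infinite.\<close>

lemma infinite_disjoint_refinement:
  assumes sep: "separable_space X" and X: "Hausdorff_space X"
    and U: "openin X U" "U \<noteq> {}" "U \<inter> isol X = {}" and B: "openin X B"
  shows "\<exists>h :: nat \<Rightarrow> 'a set.
    (\<forall>n. openin X (h n) \<and> h n \<noteq> {} \<and> h n \<subseteq> U \<and> (h n \<subseteq> B \<or> h n \<inter> B = {})) \<and>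
    (\<forall>m n. m \<noteq> n \<longrightarrow> h m \<inter> h n = {}) \<and>
    (\<forall>W. openin X W \<longrightarrow> W \<noteq> {} \<longrightarrow> W \<subseteq> U \<longrightarrow> (\<exists>n. h n \<inter> W \<noteq> {}))"
proof -
  obtain x where x: "x \<in> U" using U by blast
  have Utop: "U \<subseteq> topspace X" using U openin_subset by blast
  \<comment> \<open>Keeping the non-isolated point \<open>x\<close> out of the closures prevents finitely many members
    from being dense in \<open>U\<close>, so a maximal disjoint family is infinite.\<close>
  define good where
    "good = {G. openin X G \<and> G \<noteq> {} \<and> G \<subseteq> U \<and> x \<notin> X closure_of G \<and> (G \<subseteq> B \<or> G \<inter> B = {})}"
  define \<A> where "\<A> = {C. C \<subseteq> good \<and> pairwise disjnt C}"
  \<comment> \<open>Hypothesis of Zorn's lemma: any two members of the union of a chain lie together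
    in one element of the chain.\<close>
  have "\<forall>C\<in>chains \<A>. \<Union>C \<in> \<A>"
  proof
    fix C assume "C \<in> chains \<A>"
    then have C: "C \<subseteq> \<A>" "chain\<^sub>\<subseteq> C" by (auto simp: chains_def)
    have "pairwise disjnt (\<Union>C)"
      by (rule pairwise_chain_Union) (use C in \<open>auto simp: \<A>_def\<close>)
    then show "\<Union>C \<in> \<A>" using C by (auto simp: \<A>_def)
  qed
  then obtain M where M: "M \<in> \<A>" and max: "\<And>C. C \<in> \<A> \<Longrightarrow> M \<subseteq> C \<Longrightarrow> C = M"
    using Zorn_Lemma[of \<A>] by blast
  have Mg: "M \<subseteq> good" and Md: "pairwise disjnt M"
    using M by (auto simp: \<A>_def)
  have dense: "\<exists>G\<in>M. G \<inter> W \<noteq> {}" if W: "openin X W" "W \<noteq> {}" "W \<subseteq> U" for W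
  proof (rule ccontr)
    assume no: "\<not> (\<exists>G\<in>M. G \<inter> W \<noteq> {})"
    \<comment> \<open>\<open>x\<close> is not isolated, so \<open>W\<close> has another point, near
      which a \<open>good\<close> set can be found.\<close>
    have "W \<noteq> {x}"
      using W x U Utop unfolding isol_def by auto
    then obtain y where y: "y \<in> W" "y \<noteq> x" using W(2) by blast
    moreover have "y \<in> topspace X" "x \<in> topspace X" using y W x Utop by auto
    ultimately obtain P Q where PQ: "openin X P" "openin X Q" "x \<in> P" "y \<in> Q" "disjnt P Q"
      using X unfolding Hausdorff_space_def by metis
    \<comment> \<open>The case split makes \<open>N\<close> lie in \<open>B\<close> or be disjoint
      from it; staying within \<open>Q\<close> keeps \<open>x\<close> out of its closure.\<close>
    define N where "N = (if Q \<inter> W \<inter> B = {} then Q \<inter> W else Q \<inter> W \<inter> B)"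
    have N: "openin X N" "N \<noteq> {}" "N \<subseteq> W" "N \<subseteq> Q" "N \<subseteq> B \<or> N \<inter> B = {}"
      using PQ y W B by (auto simp: N_def)
    have "P \<inter> X closure_of N = {}"
      using PQ N(4) by (subst openin_Int_closure_of_eq_empty) (auto simp: disjnt_iff)
    then have "N \<in> good"
      using N W(3) PQ(3) by (auto simp: good_def)
    moreover have "disjnt N G" if "G \<in> M" for G
      using no that N(3) by (auto simp: disjnt_iff)
    ultimately have "insert N M \<in> \<A>"
      using Mg Md by (auto simp: \<A>_def pairwise_insert disjnt_sym)
    then have "N \<in> M" using max by blast
    then show False using no N by blast
  qed
  have "infinite M"
  proof
    assume fin: "finite M"
    let ?W = "U - X closure_of (\<Union>M)"
    \<comment> \<open>For finite \<open>M\<close> the closure of the union is the union of the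
      closures.\<close>
    have "x \<notin> X closure_of (\<Union>M)"
      using Mg by (auto simp: closure_of_Union[OF fin] good_def)
    then have "openin X ?W" "?W \<noteq> {}"
      using x U by (auto intro: openin_diff)
    then obtain G where G: "G \<in> M" "G \<inter> ?W \<noteq> {}" using dense by blast
    have "\<Union>M \<subseteq> topspace X"
      using Mg Utop by (auto simp: good_def)
    then have "G \<subseteq> X closure_of (\<Union>M)"
      using G(1) closure_of_subset by blast
    then show False using G by blast
  qed
  moreover have "countable M"
    by (rule countable_disjoint_openin[OF sep Md]) (use Mg in \<open>auto simp: good_def\<close>)
  ultimately have bij: "bij_betw (from_nat_into M) UNIV M"
    by (simp add: bij_betw_from_nat_into)
  let ?h = "from_nat_into M"
  have hM: "?h n \<in> M" for n
    using bij bij_betwE by blast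
  have "?h n \<in> good" for n
    using hM Mg by blast
  moreover have "?h m \<inter> ?h n = {}" if "m \<noteq> n" for m n
  proof -
    have "?h m \<noteq> ?h n"
      using bij that unfolding bij_betw_def inj_def by blast
    then show ?thesis
      using Md hM unfolding pairwise_def disjnt_def by blast
  qed
  moreover have "\<exists>n. ?h n \<inter> W \<noteq> {}" if "openin X W" "W \<noteq> {}" "W \<subseteq> U" for W
  proof -
    obtain G where "G \<in> M" "G \<inter> W \<noteq> {}" using dense \<open>openin X W\<close> \<open>W \<noteq> {}\<close> \<open>W \<subseteq> U\<close> by blast
    moreover obtain n where "?h n = G"
      using bij \<open>G \<in> M\<close> bij_betw_imp_surj_on by (metis imageE)
    ultimately show ?thesis by blast
  qed
  ultimately show ?thesis
    unfolding good_def by (intro exI[of _ ?h]) auto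
qed

text \<open>Iterates \<open>infinite_disjoint_refinement\<close> along finite sequences, giving the
  pattern of the cylinder sets of the Baire space. Infinite branching at every node makes the
  pattern independent of the space.\<close>

lemma open_set_tree:
  assumes sc: "second_countable X" and X: "Hausdorff_space X"
    and U: "openin X U" "U \<noteq> {}" "U \<inter> isol X = {}"
  obtains V :: "nat list \<Rightarrow> 'a set"
  where "\<And>s. openin X (V s)" "\<And>s. V s \<noteq> {}" "\<And>s. V s \<subseteq> U"
    and "\<And>s t. V s \<inter> V t = {} \<longleftrightarrow> \<not> (suffix s t \<or> suffix t s)"
    and "\<And>W. openin X W \<Longrightarrow> W \<noteq> {} \<Longrightarrow> W \<subseteq> U \<Longrightarrow> \<exists>s. V s \<subseteq> W"
proof -
  obtain \<B> where \<B>: "countable \<B>" "\<And>B. B \<in> \<B> \<Longrightarrow> openin X B"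
    "\<And>W x. openin X W \<Longrightarrow> x \<in> W \<Longrightarrow> \<exists>B\<in>\<B>. x \<in> B \<and> B \<subseteq> W"
    using sc unfolding second_countable_def by metis
  have "\<B> \<noteq> {}"
    using \<B>(3)[OF U(1)] U(2) by blast
  \<comment> \<open>Nonemptiness keeps every value inside \<open>\<B>\<close>; if
    \<open>\<B>\<close> is finite, the enumeration merely repeats members.\<close>
  define b where "b = from_nat_into \<B>"
  have b: "openin X (b n)" for n
    using \<B>(2) from_nat_into[OF \<open>\<B> \<noteq> {}\<close>] by (simp add: b_def)
  have base: "\<exists>n. x \<in> b n \<and> b n \<subseteq> W" if W: "openin X W" "x \<in> W" for W x
  proof -
    obtain B where "B \<in> \<B>" "x \<in> B" "B \<subseteq> W"
      using \<B>(3)[OF W] by blast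
    then show ?thesis
      using from_nat_into_surj[OF \<B>(1)] unfolding b_def by metis
  qed
  have sep: "separable_space X"
    using sc by (rule second_countable_imp_separable_space)
  let ?ok = "\<lambda>P B h. (\<forall>n::nat. openin X (h n) \<and> h n \<noteq> {} \<and> h n \<subseteq> P \<and> (h n \<subseteq> B \<or> h n \<inter> B = {})) \<and>
    (\<forall>m n. m \<noteq> n \<longrightarrow> h m \<inter> h n = {}) \<and>
    (\<forall>W. openin X W \<longrightarrow> W \<noteq> {} \<longrightarrow> W \<subseteq> P \<longrightarrow> (\<exists>n. h n \<inter> W \<noteq> {}))"
  \<comment> \<open>A refinement is fixed for every pair of sets so that the tree can be defined by
    recursion.\<close>
  define H where "H P B = (SOME h. ?ok P B h)" for P B
  have H: "?ok P (b k) (H P (b k))" if P: "openin X P" "P \<noteq> {}" "P \<subseteq> U" for P k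
  proof -
    have "P \<inter> isol X = {}" using P(3) U(3) by blast
    from infinite_disjoint_refinement[OF sep X P(1,2) this b[of k]]
    show ?thesis unfolding H_def by (rule someI_ex)
  qed
  \<comment> \<open>Lists grow at the head, so the children of \<open>s\<close> are the \<open>n # s\<close>. Each member of level
    \<open>n + 1\<close> lies inside or outside \<open>b n\<close>, which makes the tree a pi-base.\<close>
  define V where "V = rec_list U (\<lambda>n s P. H P (b (length s)) n)"
  have V_Nil: "V [] = U" and V_Cons: "V (n # s) = H (V s) (b (length s)) n" for n s
    by (simp_all add: V_def)
  have V: "openin X (V s) \<and> V s \<noteq> {} \<and> V s \<subseteq> U" for s
  proof (induction s)
    case Nil
    then show ?case using U by (simp add: V_Nil)
  next
    case (Cons n s)
    then show ?case
      using H[of "V s" "length s"] unfolding V_Cons by blast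
  qed
  have H': "?ok (V s) (b (length s)) (\<lambda>n. V (n # s))" for s
    unfolding V_Cons by (rule H) (use V in auto)
  have sub: "V (n # s) \<subseteq> V s" and decided: "V (n # s) \<subseteq> b (length s) \<or> V (n # s) \<inter> b (length s) = {}"
    for n s
    using H'[of s] by simp_all
  have siblings: "V (m # s) \<inter> V (n # s) = {}" if "m \<noteq> n" for m n s
    using H'[of s] that by simp
  have children: "\<exists>n. V (n # s) \<inter> W \<noteq> {}" if "openin X W" "W \<noteq> {}" "W \<subseteq> V s" for s W
    using H'[of s] that by simp
  have append: "V (r @ s) \<subseteq> V s" for r s
  proof (induction r)
    case (Cons n r)
    then show ?case using sub[of n "r @ s"] by auto
  qed simp
  have level: "V s \<inter> V t = {}" if "length s = length t" "s \<noteq> t" for s t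
    using that
  proof (induction s t rule: list_induct2)
    case (Cons m s n t)
    show ?case
    proof (cases "s = t")
      case True
      then show ?thesis using Cons.prems siblings by simp
    next
      case False
      then show ?thesis using Cons.IH sub[of m s] sub[of n t] by blast
    qed
  qed simp
  have incomparable: "V s \<inter> V t = {}" if "length s \<le> length t" "\<not> suffix s t" for s t
  proof -
    \<comment> \<open>\<open>r\<close> is the ancestor of \<open>t\<close> on the level of
      \<open>s\<close>; the root end of a list is its tail.\<close>
    define r where "r = drop (length t - length s) t"
    have t: "t = take (length t - length s) t @ r" by (simp add: r_def)
    have "length r = length s" using that(1) by (simp add: r_def)
    moreover have "r \<noteq> s" using that(2) t unfolding suffix_def by blast
    ultimately have "V s \<inter> V r = {}" using level[of s r] by simp
    moreover have "V t \<subseteq> V r" using append t by metis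
    ultimately show ?thesis by blast
  qed
  have disj: "V s \<inter> V t = {} \<longleftrightarrow> \<not> (suffix s t \<or> suffix t s)" for s t
  proof
    have "V s \<subseteq> V t \<or> V t \<subseteq> V s" if "suffix s t \<or> suffix t s"
      using that append unfolding suffix_def by auto
    then show "\<not> (suffix s t \<or> suffix t s)" if "V s \<inter> V t = {}"
      using that V[of s] V[of t] by auto
  next
    assume "\<not> (suffix s t \<or> suffix t s)"
    then show "V s \<inter> V t = {}"
      using incomparable[of s t] incomparable[of t s] by (cases "length s \<le> length t") auto
  qed
  \<comment> \<open>Every level is dense in \<open>U\<close>: a node meeting \<open>W\<close> has a
    child meeting the same part of \<open>W\<close>.\<close>
  have dense: "\<exists>s. length s = n \<and> V s \<inter> W \<noteq> {}" if "openin X W" "W \<noteq> {}" "W \<subseteq> U" for W n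
  proof (induction n)
    case 0
    then show ?case using that V_Nil by (intro exI[of _ "[]"]) auto
  next
    case (Suc n)
    then obtain s where s: "length s = n" "V s \<inter> W \<noteq> {}" by blast
    have "openin X (V s \<inter> W)" using V that by (auto intro: openin_Int)
    then obtain k where "V (k # s) \<inter> (V s \<inter> W) \<noteq> {}"
      using children[of "V s \<inter> W" s] s(2) by blast
    then show ?case using s(1) by (intro exI[of _ "k # s"]) auto
  qed
  have "\<exists>s. V s \<subseteq> W" if W: "openin X W" "W \<noteq> {}" "W \<subseteq> U" for W
  proof -
    obtain n where n: "b n \<noteq> {}" "b n \<subseteq> W"
      using base[OF W(1)] W(2) by blast
    \<comment> \<open>The set \<open>b n\<close> is decided when passing from length
      \<open>n\<close> to \<open>Suc n\<close>, so a node of this length that meets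
      \<open>b n\<close> lies inside it.\<close>
    then obtain s where s: "length s = Suc n" "V s \<inter> b n \<noteq> {}"
      using dense[OF b[of n] n(1), of "Suc n"] W(3) by blast
    then obtain k r where "s = k # r" "length r = n"
      by (auto simp: length_Suc_conv)
    then have "V s \<subseteq> b n"
      using decided[of k r] s(2) by auto
    then show ?thesis using n by blast
  qed
  with V disj show thesis by (intro that[of V]) auto
qed

section \<open>The classification\<close>

text \<open>A nonempty open set either contains an isolated point or lies off the closure of the
  isolated points, where the tree is a pi-base. The tree occurs among the indices only when that
  open region is nonempty.\<close>

lemma pi_base_isol_tree:
  assumes "second_countable X" and X: "Hausdorff_space X"
  obtains V :: "nat list \<Rightarrow> 'a set"
  where "pi_base X (Inl ` isol X \<union> (if nonisol_part X = {} then {} else range Inr))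
      (case_sum (\<lambda>x. {x}) V)"
    and "\<And>s t. nonisol_part X \<noteq> {} \<Longrightarrow> V s \<inter> V t = {} \<longleftrightarrow> \<not> (suffix s t \<or> suffix t s)"
    and "\<And>s. nonisol_part X \<noteq> {} \<Longrightarrow> V s \<inter> isol X = {}"
proof -
  define W where "W = topspace X - isol_closure X"
  have W: "nonisol_part X = {} \<longleftrightarrow> W = {}"
    unfolding nonisol_part_def W_def by (simp add: closure_of_eq_empty)
  have isol: "isol X \<subseteq> topspace X" "\<And>x. x \<in> isol X \<Longrightarrow> openin X {x}"
    by (auto simp: isol_def)
  have opW: "openin X W"
    unfolding W_def isol_closure_def by (simp add: openin_diff)
  have disjW: "W \<inter> isol X = {}"
    using closure_of_subset[OF isol(1)] unfolding W_def isol_closure_def by blast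
  have subW: "U \<subseteq> W" if "openin X U" "U \<inter> isol X = {}" for U
  proof -
    have "U \<inter> X closure_of isol X = {}"
      using that openin_Int_closure_of_eq_empty by blast
    then show ?thesis
      using openin_subset[OF that(1)] unfolding W_def isol_closure_def by blast
  qed
  show thesis
  proof (cases "W = {}")
    case True
    have "\<exists>x\<in>isol X. {x} \<subseteq> U" if "openin X U" "U \<noteq> {}" for U
      using subW[OF that(1)] that(2) True by blast
    then have "pi_base X (Inl ` isol X) (case_sum (\<lambda>x. {x}) V)" for V :: "nat list \<Rightarrow> 'a set"
      using isol(2) unfolding pi_base_def by simp
    then show thesis
      using that True W by simp
  next
    case False
    obtain V :: "nat list \<Rightarrow> 'a set"
      where V: "\<And>s. openin X (V s)" "\<And>s. V s \<noteq> {}" "\<And>s. V s \<subseteq> W"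
        and disj: "\<And>s t. V s \<inter> V t = {} \<longleftrightarrow> \<not> (suffix s t \<or> suffix t s)"
        and dense: "\<And>U. openin X U \<Longrightarrow> U \<noteq> {} \<Longrightarrow> U \<subseteq> W \<Longrightarrow> \<exists>s. V s \<subseteq> U"
      using open_set_tree[OF assms opW False disjW] by blast
    have "(\<exists>x\<in>isol X. {x} \<subseteq> U) \<or> (\<exists>s. V s \<subseteq> U)" if "openin X U" "U \<noteq> {}" for U
    proof (cases "U \<inter> isol X = {}")
      case True
      then show ?thesis using dense[OF that subW[OF that(1) True]] by blast
    qed blast
    then have "pi_base X (Inl ` isol X \<union> range Inr) (case_sum (\<lambda>x. {x}) V)"
      using isol(2) V unfolding pi_base_def by (simp add: ball_Un bex_Un)
    moreover have "V s \<inter> isol X = {}" for s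
      using V(3) disjW by blast
    ultimately show thesis
      using that[of V] disj False W by simp
  qed
qed

text \<open>A bijection of the isolated points together with the identity on finite sequences
  matches the two index sets. The patterns agree because distinct singletons are disjoint,
  singletons miss the tree, and both trees follow the suffix order.\<close>

lemma boolean_equivalentI:
  assumes scX: "second_countable X" and X: "Hausdorff_space X"
    and scY: "second_countable Y" and Y: "Hausdorff_space Y"
    and isol: "isol X \<approx> isol Y" and nonisol: "nonisol_part X = {} \<longleftrightarrow> nonisol_part Y = {}"
  shows "boolean_equivalent X Y"
proof -
  obtain g where g: "bij_betw g (isol X) (isol Y)"
    using isol unfolding eqpoll_def by blast
  let ?I = "Inl ` isol X \<union> (if nonisol_part X = {} then {} else range Inr) :: ('a + nat list) set"
  obtain V :: "nat list \<Rightarrow> 'a set" where V: "pi_base X ?I (case_sum (\<lambda>x. {x}) V)"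
    "\<And>s t. nonisol_part X \<noteq> {} \<Longrightarrow> V s \<inter> V t = {} \<longleftrightarrow> \<not> (suffix s t \<or> suffix t s)"
    "\<And>s. nonisol_part X \<noteq> {} \<Longrightarrow> V s \<inter> isol X = {}"
    using that by (rule pi_base_isol_tree[OF scX X])
  obtain W :: "nat list \<Rightarrow> 'b set"
    where W: "pi_base Y (Inl ` isol Y \<union> (if nonisol_part Y = {} then {} else range Inr))
      (case_sum (\<lambda>x. {x}) W)"
    "\<And>s t. nonisol_part Y \<noteq> {} \<Longrightarrow> W s \<inter> W t = {} \<longleftrightarrow> \<not> (suffix s t \<or> suffix t s)"
    "\<And>s. nonisol_part Y \<noteq> {} \<Longrightarrow> W s \<inter> isol Y = {}"
    using that by (rule pi_base_isol_tree[OF scY Y])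
  have "Inl ` isol Y \<union> (if nonisol_part Y = {} then {} else range Inr)
      = map_sum g id ` ?I"
    using g nonisol by (auto simp: bij_betw_def image_Un image_image)
  with W(1) have "pi_base Y (map_sum g id ` ?I) (case_sum (\<lambda>x. {x}) W)"
    by simp
  \<comment> \<open>The pi-base of \<open>Y\<close> is reindexed by the index set of
    \<open>X\<close>, as \<open>boolean_equivalent_pi_bases\<close> requires a common one.\<close>
  then have "pi_base Y ?I (\<lambda>i. case_sum (\<lambda>x. {x}) W (map_sum g id i))"
    unfolding pi_base_def ball_simps bex_simps .
  from V(1) this show ?thesis
  proof (rule boolean_equivalent_pi_bases)
    fix i j assume i: "i \<in> ?I" and j: "j \<in> ?I"
    have inj: "g x = g y \<longleftrightarrow> x = y" if "x \<in> isol X" "y \<in> isol X" for x y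
      using g that by (auto simp: bij_betw_def inj_on_def)
    have gY: "g x \<in> isol Y" if "x \<in> isol X" for x
      using bij_betw_apply[OF g that] .
    show "case_sum (\<lambda>x. {x}) V i \<inter> case_sum (\<lambda>x. {x}) V j = {} \<longleftrightarrow>
      case_sum (\<lambda>x. {x}) W (map_sum g id i) \<inter> case_sum (\<lambda>x. {x}) W (map_sum g id j) = {}"
    proof (cases i; cases j)
      fix x y assume "i = Inl x" "j = Inl y"
      then show ?thesis using i j inj[of x y] by (auto split: if_splits)
    next
      fix x s assume eq: "i = Inl x" "j = Inr s"
      then have "x \<in> isol X" "nonisol_part X \<noteq> {}"
        using i j by (auto split: if_splits)
      then show ?thesis using eq V(3)[of s] W(3)[of s] gY[of x] nonisol by auto
    next
      fix x s assume eq: "i = Inr s" "j = Inl x"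
      then have "x \<in> isol X" "nonisol_part X \<noteq> {}"
        using i j by (auto split: if_splits)
      then show ?thesis using eq V(3)[of s] W(3)[of s] gY[of x] nonisol by auto
    next
      fix s t assume eq: "i = Inr s" "j = Inr t"
      then have "nonisol_part X \<noteq> {}"
        using i by (auto split: if_splits)
      then show ?thesis using eq V(2) W(2) nonisol by simp
    qed
  qed
qed

section \<open>Compact metric spaces\<close>

text \<open>Compactness gives total boundedness, and the balls of radius
  \<open>inverse (Suc n)\<close> around finite nets, over all \<open>n\<close>, form a countable
  base.\<close>

lemma second_countable_compact_metric:
  assumes "compact_space (mtopology_of m)"
  shows "second_countable (mtopology_of m)"
proof -
  interpret Metric_space "mspace m" "mdist m"
    by (rule Metric_space_mspace_mdist)
  have "mtotally_bounded (mspace m)"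
    using assms compact_space_eq_mcomplete_mtotally_bounded by (simp add: mtopology_of_def)
  then have "\<exists>K. finite K \<and> K \<subseteq> mspace m \<and> mspace m \<subseteq> (\<Union>x\<in>K. mball x (inverse (Suc n)))" for n
    unfolding mtotally_bounded_def by (simp add: of_nat_Suc del: of_nat_Suc)
  then obtain K where K: "\<And>n. finite (K n)" "\<And>n. K n \<subseteq> mspace m"
    "\<And>n. mspace m \<subseteq> (\<Union>x\<in>K n. mball x (inverse (Suc n)))"
    by metis
  let ?B = "\<Union>n. (\<lambda>x. mball x (inverse (Suc n))) ` K n"
  have "countable ?B"
    using K(1) by (auto intro: countable_finite)
  moreover have "\<exists>V\<in>?B. x \<in> V \<and> V \<subseteq> U" if U: "openin mtopology U" "x \<in> U" for U x
  proof -
    obtain r where r: "r > 0" "mball x r \<subseteq> U" and x: "x \<in> mspace m"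
      using U unfolding openin_mtopology by blast
    \<comment> \<open>Half of \<open>r\<close> suffices because two points of a ball are less than
      twice its radius apart.\<close>
    obtain n where n: "inverse (Suc n) < r / 2"
      using reals_Archimedean[of "r/2"] r(1) by auto
    obtain c where c: "c \<in> K n" "x \<in> mball c (inverse (Suc n))"
      using K(3)[of n] x by blast
    have "mball c (inverse (Suc n)) \<subseteq> mball x r"
    proof
      fix y assume y: "y \<in> mball c (inverse (Suc n))"
      then have "mdist m x y \<le> mdist m c x + mdist m c y"
        using c(2) triangle[of x c y] x by (auto simp: commute)
      also have "\<dots> < r" using y c(2) n by auto
      finally show "y \<in> mball x r" using y x by auto
    qed
    with c r show ?thesis by blast
  qed
  ultimately show ?thesis
    unfolding second_countable_def mtopology_of_def by (intro exI[of _ ?B]) auto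
qed

theorem theorem5p7:
  fixes mX :: "'a metric" and mY :: "'b metric"
  assumes "compact_space (mtopology_of mX)" and "compact_space (mtopology_of mY)"
  shows "boolean_equivalent (mtopology_of mX) (mtopology_of mY) \<longleftrightarrow>
    isol (mtopology_of mX) \<approx> isol (mtopology_of mY) \<and>
    ((nonisol_part (mtopology_of mX) = {} \<and> nonisol_part (mtopology_of mY) = {}) \<or>
     (nonisol_part (mtopology_of mX) \<noteq> {} \<and> nonisol_part (mtopology_of mY) \<noteq> {}))"
proof -
  \<comment> \<open>Compactness enters as second countability, which the converse direction uses to
    build the trees.\<close>
  note sc = second_countable_compact_metric[OF assms(1)] second_countable_compact_metric[OF assms(2)]
  have X: "Hausdorff_space (mtopology_of mX)" and Y: "Hausdorff_space (mtopology_of mY)"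
    by (simp_all add: Metric_space.Hausdorff_space_mtopology mtopology_of_def)
  show ?thesis
    using boolean_equivalentD[OF X Y] boolean_equivalentI[OF sc(1) X sc(2) Y] by blast
qed

end
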